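(* Let $q\ge2$ and $n_0\ge0$ be integers, let $x\colon\mathbb{N}_0\to\mathbb{C}$, and let $v\colon\mathbb{N}_0\to\mathbb{C}^D$ be a sequence whose first component is $x$, together with matrices $A_0,\dots,A_{q-1}\in\mathbb{C}^{D\times D}$ such that $v(qn+r)=A_rv(n)$ for all $0\le r<q$ and all $n\ge n_0$. For $0\le k<n_0$ let $\delta_k\colon\mathbb{N}_0\to\mathbb{C}$, $\delta_k(n)=[n=k]$. For $0\le r<q$ and $0\le k<n_0$ let $w_{r,k}\coloneqq v(qk+r)-A_rv(k)\in\mathbb{C}^D$, let $W_r$ be the $D\times n_0$ matrix with columns $w_{r,0},\dots,w_{r,n_0-1}$, and let $J_r\in\{0,1\}^{n_0\times n_0}$ be the matrix whose entry in row $k$ and column $j$ ($0\le k,j<n_0$) is $[jq=k-r]$. Define \[\widetilde v=\begin{pmatrix}v\\ \delta_0\\ \vdots\\ \delta_{n_0-1}\end{pmatrix},\qquad \widetilde A_r=\begin{pmatrix}A_r&W_r\\0&J_r\end{pmatrix}\quad(0\le r<q).\] Then $\widetilde v(qn+r)=\widetilde A_r\widetilde v(n)$ holds for all $0\le r<q$ and all $n\ge0$; hence $(\widetilde A_0,\dots,\widetilde A_{q-1},\widetilde v)$ is a $q$-linear representation of $x$ and $x$ is $q$-regular. Moreover, each $J_r$ is lower triangular with diagonal $([r=0],0,\dots,0)$.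
   Context: $[S]$ denotes the Iverson bracket. A $q$-linear representation of $x$ is a tuple $(B_0,\dots,B_{q-1},w)$ with $w\colon\mathbb{N}_0\to\mathbb{C}^{E}$ having first component $x$ and $w(qn+r)=B_rw(n)$ for all $0\le r<q$, $n\ge0$; $x$ is $q$-regular if it has such a representation (equivalently, the $\mathbb{C}$-span of $\{n\mapsto x(q^jn+r): j\ge0,\ 0\le r<q^j\}$ is finite-dimensional). *)

theory Defs
  imports Complex_Main "Jordan_Normal_Form.Matrix"
begin

text \<open>
  A family of matrices indexed by \<open>0 \<le> r < q\<close> is a function on \<open>nat\<close> of which only the values
  at \<open>r < q\<close> matter. The dimension \<open>E\<close> is positive because the vectors have a first component.
\<close>

definition linear_representation ::
  "nat \<Rightarrow> (nat \<Rightarrow> complex) \<Rightarrow> nat \<Rightarrow> (nat \<Rightarrow> complex mat) \<Rightarrow> (nat \<Rightarrow> complex vec) \<Rightarrow> bool" where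
  "linear_representation q x E B w \<longleftrightarrow>
     0 < E \<and>
     (\<forall>r<q. B r \<in> carrier_mat E E) \<and>
     (\<forall>n. w n \<in> carrier_vec E) \<and>
     (\<forall>n. w n $ 0 = x n) \<and>
     (\<forall>r<q. \<forall>n. w (q * n + r) = B r *\<^sub>v w n)"

definition regular_sequence :: "nat \<Rightarrow> (nat \<Rightarrow> complex) \<Rightarrow> bool" where
  "regular_sequence q x \<longleftrightarrow> (\<exists>E B w. linear_representation q x E B w)"

definition delta :: "nat \<Rightarrow> nat \<Rightarrow> complex" where
  "delta k n = of_bool (n = k)"

definition W_col ::
  "nat \<Rightarrow> (nat \<Rightarrow> complex mat) \<Rightarrow> (nat \<Rightarrow> complex vec) \<Rightarrow> nat \<Rightarrow> nat \<Rightarrow> complex vec" where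
  "W_col q A v r k = v (q * k + r) - A r *\<^sub>v v k"

definition W_mat ::
  "nat \<Rightarrow> nat \<Rightarrow> nat \<Rightarrow> (nat \<Rightarrow> complex mat) \<Rightarrow> (nat \<Rightarrow> complex vec) \<Rightarrow> nat \<Rightarrow> complex mat" where
  "W_mat q n0 D A v r = mat_of_cols D (map (W_col q A v r) [0..<n0])"

text \<open>The difference \<open>k - r\<close> may be negative, so it is taken in the integers.\<close>

definition J_mat :: "nat \<Rightarrow> nat \<Rightarrow> nat \<Rightarrow> complex mat" where
  "J_mat q n0 r = mat n0 n0 (\<lambda>(k, j). of_bool (int j * int q = int k - int r))"

definition v_tilde :: "nat \<Rightarrow> (nat \<Rightarrow> complex vec) \<Rightarrow> nat \<Rightarrow> complex vec" where
  "v_tilde n0 v n = v n @\<^sub>v vec n0 (\<lambda>k. delta k n)"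

definition A_tilde ::
  "nat \<Rightarrow> nat \<Rightarrow> nat \<Rightarrow> (nat \<Rightarrow> complex mat) \<Rightarrow> (nat \<Rightarrow> complex vec) \<Rightarrow> nat \<Rightarrow> complex mat" where
  "A_tilde q n0 D A v r =
     four_block_mat (A r) (W_mat q n0 D A v r) (0\<^sub>m n0 D) (J_mat q n0 r)"

definition lower_triangular :: "'a::zero mat \<Rightarrow> bool" where
  "lower_triangular M \<longleftrightarrow> (\<forall>i<dim_row M. \<forall>j<dim_col M. i < j \<longrightarrow> M $$ (i, j) = 0)"

end

theory Submission
  imports Defs
begin

text \<open>The recurrence for \<open>v\<close> fails only at the finitely many
  \<open>n < n0\<close>, and the delta sequences record exactly which of these \<open>n\<close>
  occurs. Multiplying a matrix by the vector of deltas at \<open>n\<close> selects its column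
  \<open>n\<close>, or gives zero once \<open>n \<ge> n0\<close>
  (\<open>mult_mat_vec_delta\<close>). So \<open>W_mat\<close> adds the missing error term
  \<open>W_col\<close> for small \<open>n\<close> and vanishes afterwards, while the deltas are
  themselves closed under n \<mapsto> q n + r by means of \<open>J_mat\<close>
  (\<open>J_mat_mult_delta\<close>). Reading the block product row by row gives the recurrence for
  all \<open>n\<close> (\<open>v_tilde_recurrence\<close>). The shape of \<open>J_mat\<close>
  follows from j q \<ge> j, strictly so for j > 0.\<close>

lemma mult_mat_vec_delta:
  assumes "M \<in> carrier_mat m n0"
  shows "M *\<^sub>v vec n0 (\<lambda>k. delta k n) = (if n < n0 then col M n else 0\<^sub>v m)"
proof (rule eq_vecI)
  fix i
  assume "i < dim_vec (if n < n0 then col M n else 0\<^sub>v m)"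
  then have i: "i < m"
    using assms by (auto split: if_splits)
  have "(M *\<^sub>v vec n0 (\<lambda>k. delta k n)) $ i = (\<Sum>j\<in>{0..<n0}. M $$ (i, j) * of_bool (n = j))"
    using assms i by (auto simp: scalar_prod_def delta_def intro!: sum.cong)
  also have "\<dots> = (if n < n0 then M $$ (i, n) else 0)"
    by (simp add: of_bool_def if_distrib sum.delta' cong: if_cong)
  also have "\<dots> = (if n < n0 then col M n else 0\<^sub>v m) $ i"
    using assms i by simp
  finally show "(M *\<^sub>v vec n0 (\<lambda>k. delta k n)) $ i = \<dots>" .
qed (use assms in auto)

text \<open>Column \<open>n\<close> of \<open>J_mat\<close> has its only possible 1 in row q n + r,
  so it is the delta vector at q n + r, which is zero if that row lies outside the matrix.\<close>

lemma J_mat_mult_delta: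
  assumes "q \<ge> 1"
  shows "J_mat q n0 r *\<^sub>v vec n0 (\<lambda>k. delta k n) = vec n0 (\<lambda>k. delta k (q * n + r))"
proof -
  have shift: "int n * int q = int k - int r \<longleftrightarrow> q * n + r = k" for k
    by (simp add: eq_diff_eq mult.commute flip: of_nat_mult of_nat_add)
  \<comment> \<open>For \<open>n \<ge> n0\<close> the left side is zero; the right side is too,
    since q n + r \<ge> n lies beyond every delta.\<close>
  have small: "q * n + r \<noteq> k" if "n \<ge> n0" "k < n0" for k
  proof -
    have "n \<le> q * n"
      using assms by simp
    with that show ?thesis
      by linarith
  qed
  have "J_mat q n0 r *\<^sub>v vec n0 (\<lambda>k. delta k n)
      = (if n < n0 then col (J_mat q n0 r) n else 0\<^sub>v n0)"
    by (rule mult_mat_vec_delta) (simp add: J_mat_def)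
  also have "\<dots> = vec n0 (\<lambda>k. delta k (q * n + r))"
    by (rule eq_vecI) (auto simp: J_mat_def delta_def shift small)
  finally show ?thesis .
qed

lemma lower_triangular_J_mat:
  assumes "q \<ge> 1"
  shows "lower_triangular (J_mat q n0 r)"
proof -
  have "int j * int q \<noteq> int i - int r" if "i < j" for i j
  proof -
    \<comment> \<open>Above the diagonal, j q \<ge> j > i \<ge> i - r.\<close>
    have "int j * 1 \<le> int j * int q"
      using assms by (intro mult_left_mono) auto
    with that show ?thesis
      by linarith
  qed
  then show ?thesis
    by (simp add: lower_triangular_def J_mat_def)
qed

text \<open>For k > 0, k q \<ge> 2 k > k - r excludes a diagonal 1. This needs q \<ge> 2: with q = 1
  and r = 0 the matrix is the identity.\<close>

lemma diag_J_mat: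
  assumes "q \<ge> 2"
  shows "diag_mat (J_mat q n0 r) = map (\<lambda>k. if k = 0 then of_bool (r = 0) else 0) [0..<n0]"
proof -
  have "int k * int q \<noteq> int k - int r" if "k > 0" for k
  proof -
    have "int k * 2 \<le> int k * int q"
      using assms by (intro mult_left_mono) auto
    with that show ?thesis
      by linarith
  qed
  then show ?thesis
    by (auto simp: diag_mat_def J_mat_def)
qed

lemma v_tilde_recurrence:
  assumes "q \<ge> 1"
    and v: "\<And>n. v n \<in> carrier_vec D"
    and A: "A r \<in> carrier_mat D D"
    and rec: "\<And>n. n \<ge> n0 \<Longrightarrow> v (q * n + r) = A r *\<^sub>v v n"
  shows "v_tilde n0 v (q * n + r) = A_tilde q n0 D A v r *\<^sub>v v_tilde n0 v n"
proof -
  let ?d = "\<lambda>n. vec n0 (\<lambda>k. delta k n)"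
  have W: "W_mat q n0 D A v r \<in> carrier_mat D n0"
    by (simp add: W_mat_def mat_of_cols_def)
  have J: "J_mat q n0 r \<in> carrier_mat n0 n0"
    by (simp add: J_mat_def)
  have colW: "col (W_mat q n0 D A v r) n = W_col q A v r n" if "n < n0"
    using that v A by (simp add: W_mat_def W_col_def)
  \<comment> \<open>For \<open>n < n0\<close> the correction is the defect of the recurrence at
    \<open>n\<close> and cancels \<open>A r *\<^sub>v v n\<close>; for \<open>n \<ge> n0\<close> it
    is zero and the hypothesis \<open>rec\<close> applies.\<close>
  have top: "A r *\<^sub>v v n + W_mat q n0 D A v r *\<^sub>v ?d n = v (q * n + r)"
  proof (cases "n < n0")
    case True
    then have "A r *\<^sub>v v n + W_mat q n0 D A v r *\<^sub>v ?d n = A r *\<^sub>v v n + W_col q A v r n"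
      by (simp add: mult_mat_vec_delta[OF W] colW)
    also have "\<dots> = v (q * n + r)"
      using v[of "q * n + r"] v[of n] A by (intro eq_vecI) (auto simp: W_col_def)
    finally show ?thesis .
  next
    case False
    then show ?thesis
      using rec[of n] v[of "q * n + r"] by (simp add: mult_mat_vec_delta[OF W])
  qed
  have bottom: "0\<^sub>m n0 D *\<^sub>v v n + J_mat q n0 r *\<^sub>v ?d n = ?d (q * n + r)"
    unfolding J_mat_mult_delta[OF assms(1)] using v[of n] by (intro eq_vecI) auto
  have "A_tilde q n0 D A v r *\<^sub>v v_tilde n0 v n
      = (A r *\<^sub>v v n + W_mat q n0 D A v r *\<^sub>v ?d n)
        @\<^sub>v (0\<^sub>m n0 D *\<^sub>v v n + J_mat q n0 r *\<^sub>v ?d n)"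
    unfolding A_tilde_def v_tilde_def
    by (rule four_block_mat_mult_vec[OF A W zero_carrier_mat J v]) simp
  then show ?thesis
    by (simp add: top bottom v_tilde_def)
qed

theorem theorem3p10:
  fixes q n0 D :: nat
    and x :: "nat \<Rightarrow> complex"
    and v :: "nat \<Rightarrow> complex vec"
    and A :: "nat \<Rightarrow> complex mat"
  assumes "q \<ge> 2"
    and "D \<ge> 1"
    and "\<And>n. v n \<in> carrier_vec D"
    and "\<And>n. v n $ 0 = x n"
    and "\<And>r. r < q \<Longrightarrow> A r \<in> carrier_mat D D"
    and "\<And>r n. r < q \<Longrightarrow> n \<ge> n0 \<Longrightarrow> v (q * n + r) = A r *\<^sub>v v n"
  shows "(\<forall>r<q. \<forall>n. v_tilde n0 v (q * n + r) = A_tilde q n0 D A v r *\<^sub>v v_tilde n0 v n)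
    \<and> linear_representation q x (D + n0) (A_tilde q n0 D A v) (v_tilde n0 v)
    \<and> regular_sequence q x
    \<and> (\<forall>r<q. lower_triangular (J_mat q n0 r)
         \<and> diag_mat (J_mat q n0 r) = map (\<lambda>k. if k = 0 then of_bool (r = 0) else 0) [0..<n0])"
proof -
  have rec: "\<forall>r<q. \<forall>n. v_tilde n0 v (q * n + r) = A_tilde q n0 D A v r *\<^sub>v v_tilde n0 v n"
    using assms by (auto intro!: v_tilde_recurrence)
  have carrier: "A_tilde q n0 D A v r \<in> carrier_mat (D + n0) (D + n0)" if "r < q" for r
    using assms(5)[OF that] by (simp add: A_tilde_def J_mat_def)
  have "v_tilde n0 v n \<in> carrier_vec (D + n0)" for n
    using assms(3)[of n] by (simp add: v_tilde_def)
  \<comment> \<open>Since \<open>D \<ge> 1\<close>, index 0 falls into the block \<open>v n\<close>,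
    not into the deltas.\<close>
  moreover have "v_tilde n0 v n $ 0 = x n" for n
    using assms(2,4) assms(3)[of n] by (simp add: v_tilde_def)
  ultimately have rep: "linear_representation q x (D + n0) (A_tilde q n0 D A v) (v_tilde n0 v)"
    using assms(2) carrier rec by (simp add: linear_representation_def)
  then have "regular_sequence q x"
    unfolding regular_sequence_def by blast
  with rec rep show ?thesis
    using assms(1) by (simp add: lower_triangular_J_mat diag_J_mat)
qed

end
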